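(* Suppose the $n$ agents are partitioned into three nonempty groups: a group whose agents all have the same monotone cost function $C_1$, a group whose agents all have the same additive $2$-ratio-bounded cost function $C_2$, and a group consisting of a single agent with a monotone cost function $C_3$. Then a full tEFX allocation of the chores $[m]$ exists.
   Context: A cost function $C:2^{[m]}\to\mathbb{R}_{\ge0}$ is monotone if $C(S\cup\{c\})\ge C(S)$; additive if $C(S)=\sum_{c\in S}C(\{c\})$; $2$-ratio-bounded if $\max_b C(\{b\})\le 2\min_b C(\{b\})$ with positive single-chore costs. A full allocation $X=(X_1,\dots,X_n)$ (a partition of $[m]$, bundle $X_i$ to agent $i$ with cost function $C_i$) is tEFX if for all agents $i,j$ and every $c\in X_i$, $C_i(X_i\setminus\{c\})\le C_i(X_j\cup\{c\})$. *)

theory Defs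
  imports Complex_Main
begin

text \<open>Chores are the set M = {0..<m}; a cost function is C :: nat set \<Rightarrow> real,
  only its values on subsets of M matter.\<close>

definition cost_function :: "nat set \<Rightarrow> (nat set \<Rightarrow> real) \<Rightarrow> bool" where
  "cost_function M C \<longleftrightarrow> (\<forall>S. S \<subseteq> M \<longrightarrow> C S \<ge> 0)"

definition monotone_cost :: "nat set \<Rightarrow> (nat set \<Rightarrow> real) \<Rightarrow> bool" where
  "monotone_cost M C \<longleftrightarrow> cost_function M C \<and>
     (\<forall>S c. S \<subseteq> M \<longrightarrow> c \<in> M \<longrightarrow> C (S \<union> {c}) \<ge> C S)"

definition additive_cost :: "nat set \<Rightarrow> (nat set \<Rightarrow> real) \<Rightarrow> bool" where
  "additive_cost M C \<longleftrightarrow> cost_function M C \<and>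
     (\<forall>S. S \<subseteq> M \<longrightarrow> C S = (\<Sum>c\<in>S. C {c}))"

definition two_ratio_bounded :: "nat set \<Rightarrow> (nat set \<Rightarrow> real) \<Rightarrow> bool" where
  "two_ratio_bounded M C \<longleftrightarrow> (\<forall>b\<in>M. C {b} > 0) \<and>
     (\<forall>a\<in>M. \<forall>b\<in>M. C {a} \<le> 2 * C {b})"

definition full_allocation :: "nat \<Rightarrow> nat \<Rightarrow> (nat \<Rightarrow> nat set) \<Rightarrow> bool" where
  "full_allocation n m X \<longleftrightarrow>
     (\<forall>i<n. X i \<subseteq> {0..<m}) \<and>
     (\<forall>i<n. \<forall>j<n. i \<noteq> j \<longrightarrow> X i \<inter> X j = {}) \<and>
     (\<Union>i\<in>{0..<n}. X i) = {0..<m}"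

definition tEFX :: "nat \<Rightarrow> (nat \<Rightarrow> nat set \<Rightarrow> real) \<Rightarrow> (nat \<Rightarrow> nat set) \<Rightarrow> bool" where
  "tEFX n C X \<longleftrightarrow>
     (\<forall>i<n. \<forall>j<n. \<forall>c\<in>X i. C i (X i - {c}) \<le> C i (X j \<union> {c}))"

end

theory Submission
  imports Defs
begin

text \<open>
  Let \<open>L\<close> be the largest single-chore cost of \<open>C\<^sub>2\<close>. By \<open>2\<close>-ratio-boundedness a bundle whose
  \<open>C\<^sub>2\<close>-cost exceeds the smallest one by at most \<open>L\<close> (a \<open>good\<close> bundle) satisfies the tEFX
  condition for \<open>C\<^sub>2\<close>. It suffices to find a partition in which at least \<open>|G\<^sub>2| + 1\<close> bundles are
  good, at least \<open>|G\<^sub>1| + 1\<close> satisfy the tEFX condition for \<open>C\<^sub>1\<close> (are \<open>feasible\<close>), and every bundle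
  is good or feasible: then the single agent takes her cheapest bundle, and the others can still be
  served.

  Such a partition is reached by local search. Keep at least \<open>|G\<^sub>2| + 1\<close> good bundles, and improve
  the vector of \<open>C\<^sub>1\<close>-costs in the leximin order (raising the smallest entries), where entries
  above a threshold \<open>z\<close> that is met by \<open>|G\<^sub>2| + 1\<close> good bundles are not distinguished. If a bad
  bundle is infeasible, witnessed by a bundle \<open>j\<close> and a chore \<open>x\<close>, then \<open>x\<close> moves to \<open>j\<close> if \<open>j\<close> lies
  below the threshold, and to the \<open>C\<^sub>2\<close>-lightest bundle otherwise; the latter leaves the
  clipped vector no worse and shrinks the bad bundles. Otherwise all infeasible bundles are good.
  If there are \<open>|G\<^sub>2| + 1\<close> of them, the one whose witness \<open>y\<close> is \<open>C\<^sub>1\<close>-cheapest gives a chore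
  to \<open>y\<close>, and \<open>C\<^sub>2\<close>-balance among the infeasible bundles is restored by transfers that keep all of
  them above the old cost of \<open>y\<close>.
\<close>

section \<open>Greedy balancing of additive loads\<close>

text \<open>Greedy insertion: each new chore goes to a currently lightest bundle, which then exceeds
  any other by at most that one chore.\<close>

lemma ex_balanced_owner:
  fixes w :: "'a \<Rightarrow> real" and n :: nat
  assumes "finite M" and "0 < n" and "0 \<le> L" and "\<And>c. c \<in> M \<Longrightarrow> 0 \<le> w c \<and> w c \<le> L"
  shows "\<exists>a. (\<forall>c\<in>M. a c < n) \<and>
    (\<forall>i<n. \<forall>j<n. sum w {c \<in> M. a c = i} \<le> sum w {c \<in> M. a c = j} + L)"
  using assms(1,4)
proof (induction M rule: finite_induct)
  case empty
  then show ?case using \<open>0 \<le> L\<close> by simp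
next
  case (insert x M)
  define l where "l a i = sum w {c \<in> M. a c = i}" for a :: "'a \<Rightarrow> nat" and i
  obtain a where a: "\<forall>c\<in>M. a c < n" and bal: "\<And>i j. i < n \<Longrightarrow> j < n \<Longrightarrow> l a i \<le> l a j + L"
    using insert unfolding l_def by auto
  have "Min (l a ` {..<n}) \<in> l a ` {..<n}"
    using \<open>0 < n\<close> by (intro Min_in) auto
  then obtain y where y: "y < n" "l a y = Min (l a ` {..<n})"
    by auto
  then have y_min: "l a y \<le> l a i" if "i < n" for i
    using that by simp
  have sum: "sum w {c \<in> insert x M. (a(x := y)) c = i} = (if i = y then l a i + w x else l a i)" for i
  proof (cases "i = y")
    case True
    have "{c \<in> insert x M. (a(x := y)) c = y} = insert x {c \<in> M. a c = y}"
      using insert.hyps by auto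
    then show ?thesis
      using True insert.hyps by (simp add: l_def)
  next
    case False
    have "{c \<in> insert x M. (a(x := y)) c = i} = {c \<in> M. a c = i}"
      using False insert.hyps by auto
    then show ?thesis
      using False by (simp add: l_def)
  qed
  have w: "0 \<le> w x" "w x \<le> L"
    using insert.prems by auto
  have "(if i = y then l a i + w x else l a i) \<le> (if j = y then l a j + w x else l a j) + L"
    if "i < n" "j < n" for i j
    using bal[OF that] y_min[OF that(2)] w \<open>0 \<le> L\<close> by (auto split: if_splits)
  then show ?case
    using a y unfolding sum[symmetric] by (intro exI[of _ "a(x := y)"]) auto
qed

section \<open>States and measures of the local search\<close>

text \<open>Here \<open>C\<close> stands for \<open>C1\<close>, \<open>w\<close> and
  \<open>L\<close> for the single-chore costs of \<open>C2\<close> and their maximum, and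
  \<open>k\<close> for \<open>card G2 + 1\<close>. Indices below \<open>n\<close> name bundles that
  have no agent yet.\<close>

locale two_types =
  fixes M :: "'a set" and n k :: nat and C :: "'a set \<Rightarrow> real" and w :: "'a \<Rightarrow> real" and L :: real
  assumes finite_M: "finite M"
    and mono_C: "S \<subseteq> T \<Longrightarrow> T \<subseteq> M \<Longrightarrow> C S \<le> C T"
    and w_le_L: "c \<in> M \<Longrightarrow> w c \<le> L"
    and L_nonneg: "0 \<le> L"
    and L_le_2w: "c \<in> M \<Longrightarrow> L \<le> 2 * w c"
    and k_pos: "0 < k" and k_le_n: "k \<le> n"
begin

definition share :: "('a \<Rightarrow> nat) \<Rightarrow> nat \<Rightarrow> 'a set" where
  "share a i = {c \<in> M. a c = i}"

definition load :: "('a \<Rightarrow> nat) \<Rightarrow> nat \<Rightarrow> real" where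
  "load a i = sum w (share a i)"

definition good :: "('a \<Rightarrow> nat) \<Rightarrow> nat \<Rightarrow> bool" where
  "good a i \<longleftrightarrow> (\<forall>j<n. load a i \<le> load a j + L)"

definition feasible :: "('a \<Rightarrow> nat) \<Rightarrow> nat \<Rightarrow> bool" where
  "feasible a i \<longleftrightarrow>
     (\<forall>j<n. \<forall>c\<in>share a i. C (share a i - {c}) \<le> C (insert c (share a j)))"

text \<open>Ties of \<^term>\<open>C\<close> are broken by cardinality, so that the rank is strictly monotone.\<close>

definition rank :: "'a set \<Rightarrow> nat" where
  "rank S = card {T. T \<subseteq> M \<and> (C T < C S \<or> C T = C S \<and> card T < card S)}"

definition rk :: "('a \<Rightarrow> nat) \<Rightarrow> nat \<Rightarrow> nat" where
  "rk a i = rank (share a i)"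

definition valid :: "('a \<Rightarrow> nat) \<Rightarrow> nat \<Rightarrow> bool" where
  "valid a z \<longleftrightarrow> (\<forall>c\<in>M. a c < n) \<and> k \<le> card {i. i < n \<and> good a i \<and> z \<le> rk a i}"

text \<open>Decreasing \<open>potential\<close> means increasing, in the leximin order, the vector of ranks
  clipped at \<open>z\<close>.\<close>

definition potential :: "('a \<Rightarrow> nat) \<Rightarrow> nat \<Rightarrow> nat" where
  "potential a z = (\<Sum>i<n. (n + 1) ^ (2 ^ card M - min (rk a i) z))"

text \<open>Secondary measure, for steps that may leave the potential unchanged.\<close>

definition bad_size :: "('a \<Rightarrow> nat) \<Rightarrow> nat" where
  "bad_size a = (\<Sum>i | i < n \<and> \<not> good a i. card (share a i))"

section \<open>Transfers and ranks\<close>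

lemma share_subset: "share a i \<subseteq> M"
  by (auto simp: share_def)

lemma finite_share [simp]: "finite (share a i)"
  using finite_M share_subset finite_subset by blast

lemma share_update:
  "c \<in> M \<Longrightarrow> share (a(c := j)) i = (if i = j then insert c (share a i) else share a i - {c})"
  by (auto simp: share_def)

lemma load_update:
  assumes "c \<in> share a i" and "i \<noteq> j"
  shows "load (a(c := j)) = (load a)(i := load a i - w c, j := load a j + w c)"
proof
  fix l
  have c: "c \<in> M" "a c = i"
    using assms by (auto simp: share_def)
  show "load (a(c := j)) l = ((load a)(i := load a i - w c, j := load a j + w c)) l"
  proof (cases "l = i \<or> l = j")
    case True
    have "c \<notin> share a j"
      using assms by (auto simp: share_def)
    with True assms c show ?thesis
      by (auto simp: load_def share_update sum_diff1)
  next
    case False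
    then have "share (a(c := j)) l = share a l"
      using c by (auto simp: share_def)
    with False show ?thesis by (simp add: load_def)
  qed
qed

text \<open>The order is transitive, and \<open>S\<close> itself is counted for \<open>T\<close> but
  not for \<open>S\<close>.\<close>

lemma rank_less:
  assumes "S \<subseteq> M" and "T \<subseteq> M" and "C S < C T \<or> C S = C T \<and> card S < card T"
  shows "rank S < rank T"
  unfolding rank_def
proof (rule psubset_card_mono)
  show "finite {U. U \<subseteq> M \<and> (C U < C T \<or> C U = C T \<and> card U < card T)}"
    using finite_M by simp
  show "{U. U \<subseteq> M \<and> (C U < C S \<or> C U = C S \<and> card U < card S)}
      \<subset> {U. U \<subseteq> M \<and> (C U < C T \<or> C U = C T \<and> card U < card T)}"
    using assms by (intro psubsetI) auto
qed

lemma rank_strict_mono: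
  assumes "S \<subset> T" and "T \<subseteq> M"
  shows "rank S < rank T"
proof (rule rank_less)
  have "card S < card T"
    using assms finite_M finite_subset psubset_card_mono by blast
  moreover have "C S \<le> C T"
    using assms by (intro mono_C) auto
  ultimately show "C S < C T \<or> C S = C T \<and> card S < card T"
    by linarith
qed (use assms in auto)

lemma rank_mono: "S \<subseteq> T \<Longrightarrow> T \<subseteq> M \<Longrightarrow> rank S \<le> rank T"
  using rank_strict_mono[of S T] by (cases "S = T") (auto simp: psubset_eq)

lemma rank_le: "rank S \<le> 2 ^ card M"
proof -
  have "rank S \<le> card (Pow M)"
    unfolding rank_def using finite_M by (intro card_mono) auto
  then show ?thesis
    using finite_M by (simp add: card_Pow)
qed

text \<open>The form in which the search uses infeasibility: \<open>i\<close> can give up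
  \<open>c\<close> and still outrank the old bundle \<open>j\<close>. Monotonicity excludes
  \<open>j = i\<close> and allows \<open>c\<close> to be dropped from the right-hand bundle.\<close>

lemma infeasibleE:
  assumes "\<not> feasible a i"
  obtains j c where "j < n" "j \<noteq> i" "c \<in> share a i"
    "rk a j < rank (share a i - {c})"
proof -
  obtain j c where jc: "j < n" "c \<in> share a i"
      "C (insert c (share a j)) < C (share a i - {c})"
    using assms by (auto simp: feasible_def not_le)
  have sub: "insert c (share a j) \<subseteq> M"
    using jc share_subset by blast
  have "j \<noteq> i"
  proof
    assume "j = i"
    moreover have "C (share a i - {c}) \<le> C (insert c (share a i))"
      using sub \<open>j = i\<close> by (intro mono_C) auto
    ultimately show False
      using jc by simp
  qed
  moreover have r: "rank (insert c (share a j)) < rank (share a i - {c})"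
    using jc sub share_subset by (intro rank_less) blast+
  moreover have "rk a j \<le> rank (insert c (share a j))"
    unfolding rk_def using sub by (intro rank_mono) auto
  ultimately show thesis
    using that jc by auto
qed

section \<open>Leximin improvement as decrease of a sum\<close>

text \<open>Entries may fall, but not from above \<open>r\<close> to \<open>r\<close> or below. So
  each of the other \<open>n - 1\<close> terms grows by at most \<open>?p (Suc r)\<close>, and the
  new term of \<open>y\<close> is at most that too. The base \<open>n + 1\<close> makes the old term
  \<open>?p r\<close> outweigh these \<open>n\<close> amounts.\<close>

lemma leximin_sum_less:
  fixes f g :: "nat \<Rightarrow> nat"
  assumes ge: "\<And>i. i < n \<Longrightarrow> min (f i) (Suc r) \<le> g i"
    and y: "y < n" "f y = r" "Suc r \<le> g y" and "r < N"
  shows "(\<Sum>i<n. (n + 1) ^ (N - g i)) < (\<Sum>i<n. (n + 1) ^ (N - f i))"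
proof -
  let ?p = "\<lambda>e. (n + 1) ^ (N - e) :: nat"
  have anti: "?p b \<le> ?p a" if "a \<le> b" for a b
    using that by (intro power_increasing) auto
  have "?p (g i) \<le> ?p (f i) + ?p (Suc r)" if "i < n" for i
  proof (cases "f i \<le> g i")
    case True
    then show ?thesis using anti[of "f i" "g i"] by linarith
  next
    case False
    then have "Suc r \<le> g i" using ge[OF that] by linarith
    then show ?thesis using anti[of "Suc r" "g i"] by linarith
  qed
  then have "(\<Sum>i\<in>{..<n} - {y}. ?p (g i)) \<le> (\<Sum>i\<in>{..<n} - {y}. ?p (f i) + ?p (Suc r))"
    by (intro sum_mono) auto
  also have "\<dots> = (\<Sum>i\<in>{..<n} - {y}. ?p (f i)) + (n - 1) * ?p (Suc r)"
    using y by (simp add: sum.distrib)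
  finally have "(\<Sum>i<n. ?p (g i)) \<le> (\<Sum>i\<in>{..<n} - {y}. ?p (f i)) + (n - 1) * ?p (Suc r) + ?p (g y)"
    using y by (simp add: sum.remove[of "{..<n}" y])
  also have "\<dots> \<le> (\<Sum>i\<in>{..<n} - {y}. ?p (f i)) + n * ?p (Suc r)"
  proof -
    have "n * ?p (Suc r) = (n - 1) * ?p (Suc r) + ?p (Suc r)"
      using y by (cases n) auto
    then show ?thesis using anti[OF y(3)] by linarith
  qed
  also have "\<dots> < (\<Sum>i\<in>{..<n} - {y}. ?p (f i)) + ?p (f y)"
  proof -
    \<comment> \<open>With truncated subtraction, \<open>r < N\<close> ensures that the exponent
      really drops.\<close>
    have "N - r = Suc (N - Suc r)" using \<open>r < N\<close> by simp
    then have "?p r = (n + 1) * ?p (Suc r)" by simp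
    then show ?thesis using y by simp
  qed
  also have "\<dots> = (\<Sum>i<n. ?p (f i))"
    using y by (simp add: sum.remove[of "{..<n}" y])
  finally show ?thesis .
qed

lemma bad_size_le:
  assumes "\<forall>c\<in>M. a c < n"
  shows "bad_size a \<le> card M"
proof -
  have "bad_size a = card (\<Union>i\<in>{i. i < n \<and> \<not> good a i}. share a i)"
    unfolding bad_size_def by (subst card_UN_disjoint) (auto simp: share_def finite_M)
  also have "\<dots> \<le> card M"
    using finite_M share_subset by (intro card_mono) auto
  finally show ?thesis .
qed

section \<open>Restoring balance after a transfer\<close>

text \<open>The transfer of \<open>c\<close> from \<open>b\<close> to \<open>y\<close> may leave \<open>b\<close> too small; by \<open>2\<close>-ratio-boundedness it is
  repaired by at most two transfers from the heaviest members of \<open>I\<close> to \<open>b\<close>.\<close>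

lemma rebalance:
  assumes I: "I \<subseteq> {i. i < n \<and> good a i}" and b: "b \<in> I" and y: "y < n" "y \<notin> I"
    and c: "c \<in> share a b" and e: "\<And>i. i \<in> I \<Longrightarrow> e i \<in> share a i"
  obtains T a' where "T \<subseteq> I - {b}"
    "a' = (\<lambda>x. if x = c then y else if x \<in> e ` T then b else a x)"
    "\<And>i. i \<in> I \<Longrightarrow> good a' i"
proof -
  have v: "load a i \<le> load a j + L" if "i \<in> I" "j < n" for i j
    using that I by (auto simp: good_def)
  have fin: "finite I"
    using I by (rule finite_subset) simp
  have lt: "i < n" if "i \<in> I" for i
    using that I by auto
  have w: "w x \<le> L" "L \<le> 2 * w x" if "x \<in> share a i" for x i
    using that share_subset w_le_L L_le_2w by blast+
  note wc = w[OF c] and we = w[OF e]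
  have yb: "y \<noteq> b"
    using b y by auto
  have ec: "e i \<noteq> c" if "i \<in> I" "i \<noteq> b" for i
    using e[OF that(1)] c that by (auto simp: share_def)
  have l0: "load (a(c := y)) = (load a)(b := load a b - w c, y := load a y + w c)"
    using c yb by (intro load_update) auto
  have "Max (load a ` I) \<in> load a ` I"
    using fin b by (intro Max_in) auto
  then obtain p where p: "p \<in> I" "load a p = Max (load a ` I)"
    by auto
  have p_max: "load a i \<le> load a p" if "i \<in> I" for i
    using that fin by (simp add: p)
  show thesis
  \<comment> \<open>Only \<open>b\<close> got lighter, so goodness in \<open>I\<close> can fail only
    against \<open>b\<close>, and the heaviest member \<open>p\<close> decides whether it
    does.\<close>
  proof (cases "load a p \<le> load a b - w c + L")
    case True
    have "load (a(c := y)) i \<le> load (a(c := y)) j + L" if "i \<in> I" "j < n" for i j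
      using that True v[OF that] p_max[OF that(1)] wc y yb
      by (auto simp: l0)
    then show thesis
      using that[of "{}" "a(c := y)"] by (auto simp: good_def fun_eq_iff)
  next
    case p_big: False
    then have pb: "p \<noteq> b" using wc by auto
    have py: "p \<noteq> y" using p y by auto
    define a1 where "a1 = a(c := y, e p := b)"
    have ep: "e p \<in> share (a(c := y)) p"
      using e[OF p(1)] ec[OF p(1) pb] by (auto simp: share_def)
    have l1: "load a1 = (load a)(b := load a b - w c + w (e p), y := load a y + w c,
        p := load a p - w (e p))"
      unfolding a1_def load_update[OF ep pb] l0 using pb py yb by (auto simp: fun_eq_iff)
    show thesis
    \<comment> \<open>Now \<open>p\<close> itself is within \<open>L\<close> of \<open>b\<close>,
      since \<open>w c \<le> L \<le> 2 * w (e p)\<close>. Only members of \<open>I\<close> other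
      than \<open>b\<close> and \<open>p\<close> can still be too heavy.\<close>
    proof (cases "\<forall>i\<in>I - {b, p}. load a i \<le> load a b - w c + w (e p) + L")
      case True
      have "load a1 i \<le> load a1 j + L" if "i \<in> I" "j < n" for i j
        using that True v[OF that] v[OF p(1) that(2)] v[OF p(1) lt[OF b]] p_max[OF that(1)]
          wc we[OF p(1)] y yb pb py p_big
        by (auto simp: l1)
      then show thesis
        using that[of "{p}" a1] p pb ec[OF p(1) pb] by (auto simp: good_def a1_def fun_eq_iff)
    next
      case False
      let ?J = "I - {b, p}"
      have "Max (load a ` ?J) \<in> load a ` ?J"
        using fin False by (intro Max_in) auto
      then obtain q where q: "q \<in> ?J" "load a q = Max (load a ` ?J)"
        by (metis imageE)
      have q_max: "load a i \<le> load a q" if "i \<in> I" "i \<noteq> b" "i \<noteq> p" for i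
        using that fin by (simp add: q)
      have q_big: "load a q > load a b - w c + w (e p) + L"
        using False q_max by force
      have qI: "q \<in> I" and qb: "q \<noteq> b" and qp: "q \<noteq> p" and qy: "q \<noteq> y"
        using q y by auto
      define a2 where "a2 = a1(e q := b)"
      have eqp: "e q \<noteq> e p"
        using e[OF p(1)] e[OF qI] qp by (auto simp: share_def)
      have eq: "e q \<in> share a1 q"
        using e[OF qI] ec[OF qI qb] eqp by (auto simp: share_def a1_def)
      have l2: "load a2 = (load a)(b := load a b - w c + w (e p) + w (e q),
          y := load a y + w c, p := load a p - w (e p), q := load a q - w (e q))"
        unfolding a2_def load_update[OF eq qb] l1 using pb py yb qb qp qy by (auto simp: fun_eq_iff)
      \<comment> \<open>The two chores received cost at least \<open>L \<ge> w c\<close> together,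
        so \<open>b\<close> is no lighter than in \<open>a\<close>. By \<open>q_big\<close> it is
        not heavier than the old \<open>q\<close>, so it stays good.\<close>
      have "load a2 i \<le> load a2 j + L" if ij: "i \<in> I" "j < n" for i j
      proof -
        note facts = v[OF ij] v[OF p(1) ij(2)] v[OF qI ij(2)] v[OF p(1) lt[OF b]]
          v[OF ij(1) lt[OF b]] v[OF qI lt[OF b]] p_max[OF ij(1)] p_max[OF qI]
          wc we[OF p(1)] we[OF qI] p_big q_big
        have a2: "load a2 b = load a b - w c + w (e p) + w (e q)" "load a2 p = load a p - w (e p)"
          "load a2 q = load a q - w (e q)" "load a2 y = load a y + w c"
          using yb pb py qb qp qy by (simp_all add: l2)
        have a2_other: "load a2 l = load a l" if "l \<noteq> b" "l \<noteq> p" "l \<noteq> q" "l \<noteq> y" for l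
          using that by (simp add: l2)
        have a2_y: "load a y \<le> load a2 y"
          using a2(4) wc by linarith
        have iy: "i \<noteq> y"
          using ij y by auto
        consider (b) "load a2 i = load a b - w c + w (e p) + w (e q)"
          | (p) "load a2 i = load a p - w (e p)" | (q) "load a2 i = load a q - w (e q)"
          | (other) "load a2 i = load a i" "load a i \<le> load a q"
          using q_max[OF ij(1)] a2(1-3) a2_other[of i] iy by metis
        note i_cases = this
        consider (b) "load a2 j = load a b - w c + w (e p) + w (e q)"
          | (p) "load a2 j = load a p - w (e p)" | (q) "load a2 j = load a q - w (e q)"
          | (other) "load a j \<le> load a2 j"
          using a2(1-3) a2_other[of j] a2_y order_refl by metis
        then show ?thesis
          by (cases; cases rule: i_cases) (use facts in linarith)+
      qed
      then show thesis
        using that[of "{p, q}" a2] p pb qI qb ec[OF p(1) pb] ec[OF qI qb]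
        by (auto simp: good_def a1_def a2_def fun_eq_iff)
    qed
  qed
qed

section \<open>Transfers out of a bad bundle\<close>

text \<open>A bad \<open>u\<close> exceeds some bundle by more than \<open>L\<close>, so every good
  bundle is lighter than \<open>u\<close>. As \<open>u\<close> loses at most \<open>L\<close>, it
  stays within \<open>L\<close> of them.\<close>

lemma good_transfer_from_bad:
  assumes "u < n" "\<not> good a u" "x \<in> share a u" "j \<noteq> u" "good a i" "i \<noteq> j"
  shows "good (a(x := j)) i"
proof -
  have x: "w x \<le> L" "L \<le> 2 * w x"
    using assms(3) share_subset w_le_L L_le_2w by blast+
  obtain l where l: "l < n" "load a u > load a l + L"
    using assms(2) by (auto simp: good_def not_le)
  have "i \<noteq> u" using assms by auto
  have "load (a(x := j)) i \<le> load (a(x := j)) i' + L" if "i' < n" for i'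
  proof -
    have "load a i \<le> load a i' + L" "load a i \<le> load a l + L"
      using assms(5) that l by (auto simp: good_def)
    then show ?thesis
      using l x assms(4,6) \<open>i \<noteq> u\<close> by (auto simp: load_update[OF assms(3) assms(4)[symmetric]])
  qed
  then show ?thesis by (simp add: good_def)
qed

text \<open>Being lightest, \<open>y\<close> ends at most \<open>L\<close> above every old load. The
  reduced \<open>u\<close> is no obstacle: it was more than \<open>L\<close> above some bundle, so
  it stays above the old \<open>y\<close>.\<close>

lemma good_transfer_to_lightest:
  assumes "u < n" "\<not> good a u" "x \<in> share a u" "y \<noteq> u" "\<And>i. i < n \<Longrightarrow> load a y \<le> load a i"
  shows "good (a(x := y)) y"
proof -
  have x: "w x \<le> L" "L \<le> 2 * w x"
    using assms(3) share_subset w_le_L L_le_2w by blast+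
  obtain l where l: "l < n" "load a u > load a l + L"
    using assms(2) by (auto simp: good_def not_le)
  have "load (a(x := y)) y \<le> load (a(x := y)) i + L" if "i < n" for i
    using assms(5)[OF that] assms(5)[OF l(1)] l x assms(4)
    by (auto simp: load_update[OF assms(3) assms(4)[symmetric]])
  then show ?thesis by (simp add: good_def)
qed

lemma validI:
  assumes "\<forall>c\<in>M. a c < n" "G \<subseteq> {i. i < n \<and> good a i \<and> z \<le> rk a i}" "k \<le> card G"
  shows "valid a z"
proof -
  have "card G \<le> card {i. i < n \<and> good a i \<and> z \<le> rk a i}"
    using assms(2) by (intro card_mono) auto
  then show ?thesis
    using assms by (simp add: valid_def)
qed

section \<open>The improving steps\<close>

lemma descent_bad:
  assumes valid: "valid a z" and u: "u < n" "\<not> good a u" "\<not> feasible a u"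
  shows "\<exists>a'. valid a' z \<and> (potential a' z < potential a z \<or>
    potential a' z \<le> potential a z \<and> bad_size a' < bad_size a)"
proof -
  obtain j x where j: "j < n" "j \<noteq> u" and x: "x \<in> share a u"
      and rj: "rk a j < rank (share a u - {x})"
    using infeasibleE[OF u(3)] by metis
  have xM: "x \<in> M" and wx: "0 \<le> w x" "w x \<le> L"
    using x share_subset w_le_L[of x] L_le_2w[of x] by (auto simp: share_def)
  let ?G = "{i. i < n \<and> good a i \<and> z \<le> rk a i}"
  have a: "\<forall>c\<in>M. a c < n" and G: "k \<le> card ?G"
    using valid by (auto simp: valid_def)
  have share_u: "share (a(x := l)) u = share a u - {x}" if "l \<noteq> u" for l
    using that xM by (auto simp: share_update)
  have share_l: "share (a(x := l)) l = insert x (share a l)" for l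
    using xM by (auto simp: share_update)
  have rk_u: "rk (a(x := l)) u = rank (share a u - {x})" if "l \<noteq> u" for l
    using share_u[OF that] by (simp add: rk_def)
  have rk_other: "rk (a(x := l)) i = rk a i" if "i \<noteq> u" "i \<noteq> l" for i l
  proof -
    have "share (a(x := l)) i = share a i"
      using that x by (auto simp: share_def)
    then show ?thesis by (simp add: rk_def)
  qed
  have rk_l: "rk a l < rk (a(x := l)) l" if "l \<noteq> u" for l
    unfolding rk_def share_l using that x xM share_subset[of a l]
    by (intro rank_strict_mono) (auto simp: share_def)
  show ?thesis
  proof (cases "rk a j < z")
    case True
    let ?a = "a(x := j)"
    have "?G \<subseteq> {i. i < n \<and> good ?a i \<and> z \<le> rk ?a i}"
    proof safe
      fix i assume i: "i < n" "good a i" "z \<le> rk a i"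
      \<comment> \<open>The receiver lies below the threshold and the giver is bad, so neither is
        counted by \<open>valid\<close>.\<close>
      then have "i \<noteq> j" "i \<noteq> u" using True u by auto
      with i show "good ?a i" "z \<le> rk ?a i"
        using good_transfer_from_bad[OF u(1,2) x j(2)] rk_other[of i j] by auto
    qed
    then have "valid ?a z"
      using a j G by (intro validI) auto
    moreover have "potential ?a z < potential a z"
      unfolding potential_def
    proof (rule leximin_sum_less)
      show "min (min (rk a i) z) (Suc (rk a j)) \<le> min (rk ?a i) z" if "i < n" for i
      proof -
        \<comment> \<open>Only \<open>u\<close> falls, and it stays above the old rank of
          \<open>j\<close>, the entry that rises.\<close>
        have "rk a j < rk ?a i \<or> rk ?a i = rk a i"
          using rj rk_l[OF j(2)] rk_u[OF j(2)] rk_other[of i j] by metis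
        then show ?thesis using True by linarith
      qed
      show "Suc (rk a j) \<le> min (rk ?a j) z"
        using True rk_l[OF j(2)] by auto
      show "rk a j < 2 ^ card M"
        using rj rank_le less_le_trans by blast
    qed (use j True in auto)
    ultimately show ?thesis by blast
  next
    case False
    have "Min (load a ` {..<n}) \<in> load a ` {..<n}"
      using u by (intro Min_in) auto
    then obtain y where y: "y < n" "load a y = Min (load a ` {..<n})"
      by auto
    then have y_min: "load a y \<le> load a i" if "i < n" for i
      using that by simp
    then have good_y: "good a y"
      using wx by (force simp: good_def)
    then have yu: "y \<noteq> u" using u by auto
    let ?a = "a(x := y)"
    have good: "good ?a i" if "good a i" for i
      using good_transfer_from_bad[OF u(1,2) x yu that]
        good_transfer_to_lightest[OF u(1,2) x yu y_min] by (cases "i = y") auto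
    \<comment> \<open>Without \<open>x\<close>, bundle \<open>u\<close> still outranks
      \<open>j\<close> and hence \<open>z\<close>, so clipping hides its loss.\<close>
    have clip: "min (rk a i) z \<le> min (rk ?a i) z" for i
    proof -
      have "rk a j < rk ?a i \<or> rk a i \<le> rk ?a i"
        using rj less_imp_le[OF rk_l[OF yu]] rk_u[OF yu] rk_other[of i y] order_refl by metis
      then show ?thesis using False by linarith
    qed
    have "?G \<subseteq> {i. i < n \<and> good ?a i \<and> z \<le> rk ?a i}"
    proof safe
      fix i assume i: "i < n" "good a i" "z \<le> rk a i"
      show "good ?a i" by (rule good[OF i(2)])
      show "z \<le> rk ?a i" using clip[of i] i(3) by linarith
    qed
    then have "valid ?a z"
      using a y G by (intro validI) auto
    moreover have "potential ?a z \<le> potential a z"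
      unfolding potential_def
      by (intro sum_mono power_increasing diff_le_mono2 clip) simp
    moreover have "bad_size ?a < bad_size a"
    proof -
      \<comment> \<open>The receiver \<open>y\<close> is good, so bad bundles gain nothing.\<close>
      have le: "share ?a i \<subseteq> share a i" if "\<not> good a i" for i
        using that good_y xM by (auto simp: share_update)
      have "bad_size ?a \<le> (\<Sum>i | i < n \<and> \<not> good a i. card (share ?a i))"
        unfolding bad_size_def using good by (intro sum_mono2) auto
      also have "\<dots> < bad_size a"
        unfolding bad_size_def
      proof (rule sum_strict_mono_ex1)
        show "\<forall>i\<in>{i. i < n \<and> \<not> good a i}. card (share ?a i) \<le> card (share a i)"
          using le by (simp add: card_mono)
        have "card (share ?a u) < card (share a u)"
          unfolding share_u[OF yu] using x by (intro card_Diff1_less) auto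
        then show "\<exists>i\<in>{i. i < n \<and> \<not> good a i}. card (share ?a i) < card (share a i)"
          using u by auto
      qed simp
      finally show ?thesis .
    qed
    ultimately show ?thesis by blast
  qed
qed

lemma descent_good:
  assumes valid: "valid a z" and I: "I = {i. i < n \<and> \<not> feasible a i}"
    and good: "\<And>i. i \<in> I \<Longrightarrow> good a i" and card: "k \<le> card I"
  shows "\<exists>a' z'. valid a' z' \<and> potential a' z' < potential a z"
proof -
  have a: "\<forall>c\<in>M. a c < n"
    using valid by (simp add: valid_def)
  have "\<forall>i\<in>I. \<exists>j c. j < n \<and> c \<in> share a i \<and> rk a j < rank (share a i - {c})"
    using I infeasibleE by (metis (no_types, lifting) mem_Collect_eq)
  then obtain t e where t: "\<And>i. i \<in> I \<Longrightarrow> t i < n" and e: "\<And>i. i \<in> I \<Longrightarrow> e i \<in> share a i"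
      and te: "\<And>i. i \<in> I \<Longrightarrow> rk a (t i) < rank (share a i - {e i})"
    by metis
  have "I \<noteq> {}"
    using card k_pos by auto
  \<comment> \<open>With the lowest-ranked witness, every \<open>i\<close> in \<open>I\<close> stays
    above its rank \<open>r\<close> after losing \<open>e i\<close>.\<close>
  then obtain b where b: "b \<in> I" and b_min: "\<And>i. i \<in> I \<Longrightarrow> rk a (t b) \<le> rk a (t i)"
    using ex_has_least_nat[of "\<lambda>i. i \<in> I" _ "\<lambda>i. rk a (t i)"] by blast
  define y where "y = t b"
  define r where "r = rk a y"
  have r_less: "r < rank (share a i - {e i})" if "i \<in> I" for i
    using te[OF that] b_min[OF that] by (simp add: r_def y_def)
  have r_less_rk: "r < rk a i" if "i \<in> I" for i
  proof -
    have "rank (share a i - {e i}) \<le> rk a i"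
      unfolding rk_def using share_subset by (intro rank_mono) auto
    with r_less[OF that] show ?thesis by simp
  qed
  have y: "y < n" "y \<notin> I"
    using t[OF b] r_less_rk[of y] by (auto simp: y_def[symmetric] r_def)
  have r_bound: "r < 2 ^ card M"
    using r_less[OF b] rank_le less_le_trans by blast
  show ?thesis
  proof (cases "z \<le> r")
    case True
    \<comment> \<open>Here no chore moves: the \<open>k\<close> good bundles in \<open>I\<close>
      rank above \<open>r\<close>, so raising the threshold alone improves the clipped entry of
      \<open>b\<close>.\<close>
    have "valid a (Suc r)"
      using a card good r_less_rk I by (intro validI[of a I]) (auto simp: Suc_le_eq)
    moreover have "potential a (Suc r) < potential a z"
      unfolding potential_def
      using True r_bound r_less_rk[OF b] b I
      by (intro leximin_sum_less[where y = b and r = z]) auto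
    ultimately show ?thesis by blast
  next
    case False
    have "I \<subseteq> {i. i < n \<and> good a i}"
      using I good by auto
    from rebalance[OF this b y e[OF b] e] obtain T a' where T: "T \<subseteq> I - {b}"
      and a': "a' = (\<lambda>x. if x = e b then y else if x \<in> e ` T then b else a x)"
      and good': "\<And>i. i \<in> I \<Longrightarrow> good a' i"
      by blast
    have owner: "a (e i) = i" if "i \<in> I" for i
      using e[OF that] by (simp add: share_def)
    have rk_I: "r < rk a' i" if "i \<in> I" for i
    proof -
      have "share a i - {e i} \<subseteq> share a' i"
        using T b owner by (auto simp: share_def a')
      then have "rank (share a i - {e i}) \<le> rk a' i"
        unfolding rk_def using share_subset by (intro rank_mono) auto
      with r_less[OF that] show ?thesis by simp
    qed
    have rk_y: "r < rk a' y"
    proof -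
      have "share a y \<subset> share a' y"
      proof
        show "share a y \<subseteq> share a' y"
          using T b y owner by (auto simp: share_def a')
        have "e b \<in> share a' y - share a y"
          using e[OF b] b y by (auto simp: share_def a')
        then show "share a y \<noteq> share a' y" by auto
      qed
      then show ?thesis
        unfolding r_def rk_def using share_subset by (intro rank_strict_mono) auto
    qed
    have rk_other: "rk a' i = rk a i" if "i \<notin> I" "i \<noteq> y" for i
    proof -
      have "share a' i = share a i"
        using T b that owner by (auto simp: share_def a')
      then show ?thesis by (simp add: rk_def)
    qed
    \<comment> \<open>The threshold drops to \<open>Suc r\<close> or stays there: \<open>I\<close>
      now supplies the \<open>k\<close> good bundles, all above \<open>r\<close>. Among entries
      clipped at \<open>Suc r\<close>, that of \<open>y\<close> rises from \<open>r\<close>.\<close>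
    have "valid a' (Suc r)"
    proof (rule validI[of a' I])
      show "\<forall>c\<in>M. a' c < n"
        using a y b I by (auto simp: a')
      show "I \<subseteq> {i. i < n \<and> good a' i \<and> Suc r \<le> rk a' i}"
        using I good' rk_I by (auto simp: Suc_le_eq)
    qed (rule card)
    moreover have "potential a' (Suc r) < potential a z"
      unfolding potential_def
    proof (rule leximin_sum_less)
      show "min (min (rk a i) z) (Suc r) \<le> min (rk a' i) (Suc r)" if "i < n" for i
        using rk_I[of i] rk_y rk_other[of i] by (cases "i \<in> I"; cases "i = y") auto
      show "y < n" by (rule y(1))
      show "min (rk a y) z = r" using False by (simp add: r_def)
      show "Suc r \<le> min (rk a' y) (Suc r)" using rk_y by simp
    qed (rule r_bound)
    ultimately show ?thesis by blast
  qed
qed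

section \<open>Termination of the search\<close>

lemma ex_valid_imp_result:
  assumes "valid a z"
  shows "\<exists>a. (\<forall>c\<in>M. a c < n) \<and> k \<le> card {i. i < n \<and> good a i} \<and>
    n < k + card {i. i < n \<and> feasible a i} \<and> (\<forall>i<n. good a i \<or> feasible a i)"
  using assms
\<comment> \<open>Since \<open>bad_size\<close> is at most \<open>card M\<close>, this number orders
  pairs of potential and \<open>bad_size\<close> lexicographically.\<close>
proof (induction "potential a z * (card M + 1) + bad_size a" arbitrary: a z rule: less_induct)
  case less
  have a: "\<forall>c\<in>M. a c < n" and "k \<le> card {i. i < n \<and> good a i \<and> z \<le> rk a i}"
    using less.prems by (auto simp: valid_def)
  moreover have "card {i. i < n \<and> good a i \<and> z \<le> rk a i} \<le> card {i. i < n \<and> good a i}"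
    by (intro card_mono) auto
  ultimately have k: "k \<le> card {i. i < n \<and> good a i}" by linarith
  have step: ?case if a': "valid a' z'" and
    "potential a' z' < potential a z \<or>
     potential a' z' \<le> potential a z \<and> bad_size a' < bad_size a" for a' z'
    using that(2)
  proof
    assume *: "potential a' z' < potential a z"
    have "bad_size a' \<le> card M"
      using a' by (intro bad_size_le) (simp add: valid_def)
    then have "potential a' z' * (card M + 1) + bad_size a' < Suc (potential a' z') * (card M + 1)"
      by simp
    also have "\<dots> \<le> potential a z * (card M + 1)"
      using * by (intro mult_le_mono1) simp
    finally show ?case
      by (intro less.hyps[OF _ a']) simp
  next
    assume *: "potential a' z' \<le> potential a z \<and> bad_size a' < bad_size a"
    then have "potential a' z' * (card M + 1) \<le> potential a z * (card M + 1)"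
      by (intro mult_le_mono1) simp
    then show ?case
      using * by (intro less.hyps[OF _ a']) linarith
  qed
  let ?I = "{i. i < n \<and> \<not> feasible a i}"
  show ?case
  proof (cases "\<forall>i<n. good a i \<or> feasible a i")
    case False
    then show ?thesis
      using descent_bad[OF less.prems] step by blast
  next
    case True
    have "card {i. i < n \<and> feasible a i} + card ?I = card ({i. i < n \<and> feasible a i} \<union> ?I)"
      by (subst card_Un_disjoint) auto
    also have "{i. i < n \<and> feasible a i} \<union> ?I = {..<n}"
      by auto
    finally have eq: "card {i. i < n \<and> feasible a i} + card ?I = n"
      by simp
    show ?thesis
    proof (cases "k \<le> card ?I")
      case True
      then show ?thesis
        using descent_good[OF less.prems refl] \<open>\<forall>i<n. good a i \<or> feasible a i\<close> step by blast
    next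
      case False
      then show ?thesis
        using eq a k True by (intro exI[of _ a]) auto
    qed
  qed
qed

text \<open>The search starts from a balanced allocation, where all bundles are good, with threshold
  \<open>0\<close>.\<close>

lemma ex_owner:
  "\<exists>a. (\<forall>c\<in>M. a c < n) \<and> k \<le> card {i. i < n \<and> good a i} \<and>
    n < k + card {i. i < n \<and> feasible a i} \<and> (\<forall>i<n. good a i \<or> feasible a i)"
proof -
  have "0 \<le> w c" if "c \<in> M" for c
    using w_le_L[OF that] L_le_2w[OF that] by linarith
  then obtain a where a: "\<forall>c\<in>M. a c < n"
      and "\<forall>i<n. \<forall>j<n. sum w {c \<in> M. a c = i} \<le> sum w {c \<in> M. a c = j} + L"
    using ex_balanced_owner[OF finite_M _ L_nonneg, of n w] w_le_L k_pos k_le_n by auto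
  then have "good a i" if "i < n" for i
    using that by (auto simp: good_def load_def share_def)
  then have "valid a 0"
    using a k_le_n by (intro validI[of a "{..<n}"]) auto
  then show ?thesis
    by (rule ex_valid_imp_result)
qed

end

section \<open>Distributing the bundles to the agents\<close>

lemma monotone_cost_mono:
  assumes C: "monotone_cost M C" and "finite M" and S: "S \<subseteq> T" and T: "T \<subseteq> M"
  shows "C S \<le> C T"
proof -
  have "C S \<le> C (S \<union> F)" if "finite F" "F \<subseteq> M" for F
    using that
  proof (induction F rule: finite_induct)
    case empty
    then show ?case by simp
  next
    case (insert x F)
    have "C (S \<union> F) \<le> C (S \<union> F \<union> {x})"
      using C insert.prems S T unfolding monotone_cost_def by simp
    with insert show ?case by simp
  qed
  from this[of T] show ?thesis
    using assms finite_subset[of T M] by (simp add: Un_absorb1)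
qed

theorem theorem3:
  fixes n m :: nat and G1 G2 :: "nat set" and a3 :: nat
    and C1 C2 C3 :: "nat set \<Rightarrow> real"
  assumes "G1 \<noteq> {}" and "G2 \<noteq> {}"
    and "G1 \<inter> G2 = {}" and "a3 \<notin> G1" and "a3 \<notin> G2"
    and "G1 \<union> G2 \<union> {a3} = {0..<n}"
    and "monotone_cost {0..<m} C1"
    and "additive_cost {0..<m} C2" and "two_ratio_bounded {0..<m} C2"
    and "monotone_cost {0..<m} C3"
  shows "\<exists>X. full_allocation n m X \<and>
    tEFX n (\<lambda>i. if i \<in> G1 then C1 else if i \<in> G2 then C2 else C3) X"
proof -
  let ?M = "{0..<m}"
  define w where "w c = C2 {c}" for c
  \<comment> \<open>The added \<open>0\<close> keeps the maximum defined when there are no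
    chores.\<close>
  define L where "L = Max (insert 0 (w ` ?M))"
  have fin: "finite G1" "finite G2"
    using assms(6) by (metis finite_Un finite_atLeastLessThan)+
  have card_n: "card G1 + card G2 + 1 = n"
  proof -
    have "card (G1 \<union> G2 \<union> {a3}) = card G1 + card G2 + 1"
      using fin assms(3-5) by (subst card_Un_disjoint) (auto simp: card_Un_disjoint)
    then show ?thesis using assms(6) by simp
  qed
  interpret two_types ?M n "card G2 + 1" C1 w L
  proof
    show "C1 S \<le> C1 T" if "S \<subseteq> T" "T \<subseteq> ?M" for S T
      using monotone_cost_mono[OF assms(7)] that by simp
    show "L \<le> 2 * w c" if "c \<in> ?M" for c
      using that assms(9) by (force simp: L_def w_def two_ratio_bounded_def less_imp_le)
    show "w c \<le> L" if "c \<in> ?M" for c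
      unfolding L_def using that by (intro Max_ge) auto
  qed (use card_n in \<open>auto simp: L_def\<close>)
  obtain a where a: "\<forall>c\<in>?M. a c < n" and good: "card G2 + 1 \<le> card {i. i < n \<and> good a i}"
    and feas: "n < card G2 + 1 + card {i. i < n \<and> feasible a i}"
    and or: "\<forall>i<n. good a i \<or> feasible a i"
    using ex_owner by blast
  have C2_share: "C2 (share a i) = load a i" for i
    using assms(8) share_subset[of a i] by (auto simp: additive_cost_def load_def w_def)
  have C2_good: "C2 (share a i - {c}) \<le> C2 (share a j \<union> {c})"
    if "good a i" "j < n" "c \<in> share a i" for i j c
  proof -
    have c: "c \<in> ?M" "a c = i"
      using that by (auto simp: share_def)
    have "C2 (share a i - {c}) = load a i - w c"
      using assms(8) share_subset[of a i] that(3)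
      by (subst additive_cost_def[THEN iffD1, THEN conjunct2, rule_format])
        (auto simp: load_def w_def sum_diff1)
    also have "\<dots> \<le> C2 (share a j \<union> {c})"
    proof (cases "j = i")
      case True
      then have "share a j \<union> {c} = share a i" using that by auto
      then show ?thesis
        using C2_share w_le_L[OF c(1)] L_le_2w[OF c(1)] by simp
    next
      case False
      then have "c \<notin> share a j" using c by (auto simp: share_def)
      then have "C2 (share a j \<union> {c}) = load a j + w c"
        using assms(8) share_subset[of a j] c
        by (subst additive_cost_def[THEN iffD1, THEN conjunct2, rule_format])
          (auto simp: load_def w_def)
      moreover have "load a i \<le> load a j + L"
        using that by (simp add: good_def)
      ultimately show ?thesis
        using L_le_2w[OF c(1)] by simp
    qed
    finally show ?thesis .
  qed
  obtain f where f: "f < n" and f_min: "\<And>i. i < n \<Longrightarrow> C3 (share a f) \<le> C3 (share a i)"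
  proof -
    let ?c = "\<lambda>i. C3 (share a i)"
    have "Min (?c ` {..<n}) \<in> ?c ` {..<n}"
      using card_n by (intro Min_in) auto
    then obtain f where "f < n" "Min (?c ` {..<n}) = ?c f"
      by auto
    then show thesis
      using that[of f] by (metis Min_le finite_imageI finite_lessThan imageI lessThan_iff)
  qed
  \<comment> \<open>\<open>P\<close> serves \<open>G1\<close>: it takes all bad bundles except
    \<open>f\<close>, and only feasible ones. At most \<open>card G1\<close> bundles are bad and at
    least \<open>card G1 + 1\<close> are feasible, so the size fits even without
    \<open>f\<close>.\<close>
  obtain P where P: "{i. i < n \<and> \<not> good a i} - {f} \<subseteq> P" "P \<subseteq> {i. i < n \<and> feasible a i} - {f}"
    and card_P: "card P = card G1"
  proof -
    let ?B = "{i. i < n \<and> \<not> good a i}" and ?G = "{i. i < n \<and> good a i}"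
      and ?F = "{i. i < n \<and> feasible a i}"
    have "card ?G + card ?B = card (?G \<union> ?B)"
      by (subst card_Un_disjoint) auto
    also have "?G \<union> ?B = {..<n}" by auto
    finally have "card ?B \<le> card G1"
      using good card_n by simp
    then have "card (?B - {f}) \<le> card G1"
      using card_Diff1_le[of ?B f] by linarith
    moreover have "card ?F - 1 \<le> card (?F - {f})"
      by (simp add: card_Diff_singleton_if)
    then have "card G1 \<le> card (?F - {f})"
      using feas card_n by linarith
    moreover have "?B - {f} \<subseteq> ?F - {f}"
      using or by auto
    ultimately show thesis
      using exists_subset_between[of "?B - {f}" "card G1" "?F - {f}"] that by auto
  qed
  \<comment> \<open>What remains for \<open>G2\<close> is good, since \<open>P\<close> and
    \<open>f\<close> absorb every bad bundle.\<close>
  define Q where "Q = {..<n} - P - {f}"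
  have fin_P: "finite P"
    using P(2) finite_subset by fastforce
  have card_Q: "card Q = card G2"
  proof -
    have "card (P \<union> Q) = card P + card Q"
      using fin_P by (intro card_Un_disjoint) (auto simp: Q_def)
    moreover have "card (P \<union> Q \<union> {f}) = card (P \<union> Q) + 1"
      using fin_P P(2) by (subst card_Un_disjoint) (auto simp: Q_def)
    moreover have "P \<union> Q \<union> {f} = {..<n}"
      using P(2) f by (auto simp: Q_def)
    ultimately show ?thesis
      using card_P card_n by simp
  qed
  obtain g where g: "bij_betw g G1 P"
    using finite_same_card_bij[of G1 P] fin fin_P card_P by auto
  obtain h where h: "bij_betw h G2 Q"
    using finite_same_card_bij[of G2 Q] fin card_Q by (auto simp: Q_def)
  define s where "s i = (if i \<in> G1 then g i else if i \<in> G2 then h i else f)" for i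
  have s1: "bij_betw s G1 P"
    using g by (rule bij_betw_cong[THEN iffD1, rotated]) (simp add: s_def)
  have s2: "bij_betw s G2 Q"
    using h by (rule bij_betw_cong[THEN iffD1, rotated]) (use assms(3) in \<open>auto simp: s_def\<close>)
  have s3: "bij_betw s {a3} {f}"
    using assms(4,5) by (simp add: s_def bij_betw_def)
  have "bij_betw s (G1 \<union> G2) (P \<union> Q)"
    by (rule bij_betw_combine[OF s1 s2]) (auto simp: Q_def)
  then have "bij_betw s (G1 \<union> G2 \<union> {a3}) (P \<union> Q \<union> {f})"
    by (rule bij_betw_combine[OF _ s3]) (use P(2) in \<open>auto simp: Q_def\<close>)
  moreover have "P \<union> Q \<union> {f} = {0..<n}"
    using P(2) f by (auto simp: Q_def)
  ultimately have s: "bij_betw s {0..<n} {0..<n}"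
    using assms(6) by simp
  have s_less: "s i < n" if "i < n" for i
    using bij_betwE[OF s] that by auto
  let ?X = "\<lambda>i. share a (s i)"
  have "full_allocation n m ?X"
    unfolding full_allocation_def
  proof (intro conjI allI impI)
    show "?X i \<subseteq> ?M" for i
      by (rule share_subset)
    show "?X i \<inter> ?X j = {}" if "i < n" "j < n" "i \<noteq> j" for i j
    proof -
      have "s i \<noteq> s j"
        using s that by (auto simp: bij_betw_def inj_on_def)
      then show ?thesis by (auto simp: share_def)
    qed
    show "(\<Union>i\<in>{0..<n}. ?X i) = ?M"
    proof
      show "?M \<subseteq> (\<Union>i\<in>{0..<n}. ?X i)"
      proof
        fix c assume c: "c \<in> ?M"
        then have "a c \<in> s ` {0..<n}"
          using a s by (simp add: bij_betw_def)
        then show "c \<in> (\<Union>i\<in>{0..<n}. ?X i)"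
          using c by (auto simp: share_def)
      qed
    qed (use share_subset in auto)
  qed
  moreover have "tEFX n (\<lambda>i. if i \<in> G1 then C1 else if i \<in> G2 then C2 else C3) ?X"
    unfolding tEFX_def
  proof (intro allI impI ballI)
    fix i j c assume i: "i < n" and j: "j < n" and c: "c \<in> ?X i"
    consider "i \<in> G1" | "i \<in> G2" "i \<notin> G1" | "i = a3"
      using i assms(6) by (metis Un_iff atLeastLessThan_iff le0 singletonD)
    then show "(if i \<in> G1 then C1 else if i \<in> G2 then C2 else C3) (?X i - {c})
      \<le> (if i \<in> G1 then C1 else if i \<in> G2 then C2 else C3) (?X j \<union> {c})"
    proof cases
      case 1
      then have "feasible a (s i)"
        using bij_betwE[OF s1] P(2) by auto
      with 1 c s_less[OF j] show ?thesis
        by (simp add: feasible_def)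
    next
      case 2
      then have "s i \<in> Q"
        using bij_betwE[OF s2] by auto
      then have "good a (s i)"
        using P(1) by (auto simp: Q_def)
      with 2 show ?thesis
        using C2_good[OF _ s_less[OF j] c] by simp
    next
      case 3
      have si: "s i = f" using 3 assms(4,5) by (simp add: s_def)
      have cM: "c \<in> ?M" using c share_subset by blast
      have "C3 (share a f - {c}) \<le> C3 (share a f)"
        using share_subset by (intro monotone_cost_mono[OF assms(10)]) auto
      also have "\<dots> \<le> C3 (?X j)"
        by (rule f_min[OF s_less[OF j]])
      also have "\<dots> \<le> C3 (?X j \<union> {c})"
        using share_subset[of a "s j"] cM by (intro monotone_cost_mono[OF assms(10)]) auto
      finally show ?thesis
        using 3 assms(4,5) si by simp
    qed
  qed
  ultimately show ?thesis by blast
qed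

end
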